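(* For every $r\in\mathbb{Q}^+$ and all nontrivial subgroups $H,K$ of $(\mathbb{Q},+)$, we have $$\operatorname{lgcd}(rH)=\operatorname{plog}(r)+\operatorname{lgcd}(H),$$ $$\operatorname{lgcd}(H+K)=\min(\operatorname{lgcd}(H),\operatorname{lgcd}(K)),$$ $$\operatorname{lgcd}(H\cap K)=\max(\operatorname{lgcd}(H),\operatorname{lgcd}(K)),$$ $$\operatorname{lgcd}(HK)=\operatorname{lgcd}(H)+\operatorname{lgcd}(K),$$ where $HK=\{xy : x\in H,\ y\in K\}$ is, again, a subgroup of $(\mathbb{Q},+)$.
   Context: $\mathbb{P}$ is the set of primes, $\mathbb{Q}^+$ the set of positive rationals, and $\overline{\mathbb{Z}}=\mathbb{Z}\cup\{-\infty\}$ with $-\infty<z$ and $z+(-\infty)=(-\infty)+z=-\infty$ for all $z\in\mathbb{Z}$, and $(-\infty)+(-\infty)=-\infty$. For $r\in\mathbb{Q}^+$, $\operatorname{plog}(r)\colon\mathbb{P}\to\mathbb{Z}$ is the sequence of $p$-adic valuations of $r$. For a subset $R\subseteq\mathbb{Q}$ containing a nonzero element, $\operatorname{lgcd}(R)\colon\mathbb{P}\to\overline{\mathbb{Z}}$ is the coordinatewise infimum of $\{\operatorname{plog}(|x|):x\in R\setminus\{0\}\}$. Sums, minima and maxima of sequences are taken coordinatewise. *)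

theory Defs
  imports
    Complex_Main
    "HOL-Computational_Algebra.Primes"
    "HOL-Library.Set_Algebras"
    "HOL-Algebra.Group"
begin

datatype zbar = MInf | Fin int

instantiation zbar :: linorder
begin

fun less_eq_zbar :: "zbar \<Rightarrow> zbar \<Rightarrow> bool" where
  "MInf \<le> y \<longleftrightarrow> True"
| "Fin a \<le> MInf \<longleftrightarrow> False"
| "Fin a \<le> Fin b \<longleftrightarrow> a \<le> b"

definition less_zbar :: "zbar \<Rightarrow> zbar \<Rightarrow> bool" where
  "x < y \<longleftrightarrow> x \<le> y \<and> \<not> y \<le> (x::zbar)"

instance
proof
  fix x y z :: zbar
  show "x < y \<longleftrightarrow> x \<le> y \<and> \<not> y \<le> x" by (fact less_zbar_def)
  show "x \<le> x" by (cases x) auto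
  show "x \<le> z" if "x \<le> y" "y \<le> z" using that by (cases x; cases y; cases z) auto
  show "x = y" if "x \<le> y" "y \<le> x" using that by (cases x; cases y) auto
  show "x \<le> y \<or> y \<le> x" by (cases x; cases y) auto
qed

end

instantiation zbar :: plus
begin

fun plus_zbar :: "zbar \<Rightarrow> zbar \<Rightarrow> zbar" where
  "MInf + y = MInf"
| "Fin a + MInf = MInf"
| "Fin a + Fin b = Fin (a + b)"

instance ..

end

text \<open>
  Every nonempty subset of \<^typ>\<open>zbar\<close> has an infimum: the minimum if the subset
  consists of integers and is bounded below in the integers, and \<^const>\<open>MInf\<close>
  otherwise.  The value \<open>Inf {} = MInf\<close> carries no meaning.
\<close>

instantiation zbar :: conditionally_complete_linorder
begin

definition inf_zbar :: "zbar \<Rightarrow> zbar \<Rightarrow> zbar" where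
  "inf_zbar = min"

definition sup_zbar :: "zbar \<Rightarrow> zbar \<Rightarrow> zbar" where
  "sup_zbar = max"

definition Inf_zbar :: "zbar set \<Rightarrow> zbar" where
  "Inf X = (if X \<noteq> {} \<and> MInf \<notin> X \<and> bdd_below (Fin -` X) then Fin (Inf (Fin -` X)) else MInf)"

definition Sup_zbar :: "zbar set \<Rightarrow> zbar" where
  "Sup X = (if Fin -` X = {} then MInf else Fin (Sup (Fin -` X)))"

instance
proof
  fix x y z :: zbar and X :: "zbar set"
  show "inf x y \<le> x" "inf x y \<le> y" "x \<le> sup x y" "y \<le> sup x y"
    by (auto simp: inf_zbar_def sup_zbar_def)
  show "x \<le> inf y z" if "x \<le> y" "x \<le> z" using that by (auto simp: inf_zbar_def)
  show "sup y z \<le> x" if "y \<le> x" "z \<le> x" using that by (auto simp: sup_zbar_def)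
  show "Inf X \<le> x" if "x \<in> X"
    using that by (cases x) (auto simp: Inf_zbar_def intro: cInf_lower)
  show "z \<le> Inf X" if ne: "X \<noteq> {}" and le: "\<And>x. x \<in> X \<Longrightarrow> z \<le> x"
  proof (cases z)
    case (Fin a)
    have "MInf \<notin> X" using le Fin by fastforce
    have ge: "a \<le> b" if "b \<in> Fin -` X" for b
      using le[of "Fin b"] that Fin by auto
    have "Fin -` X \<noteq> {}"
      using ne \<open>MInf \<notin> X\<close> by (metis ex_in_conv vimageI2 zbar.exhaust)
    then have "a \<le> Inf (Fin -` X)" using ge by (rule cInf_greatest)
    moreover have "bdd_below (Fin -` X)" using ge by (rule bdd_belowI)
    ultimately show ?thesis using ne \<open>MInf \<notin> X\<close> Fin by (simp add: Inf_zbar_def)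
  qed simp
  show "x \<le> Sup X" if x: "x \<in> X" and bdd: "bdd_above X"
  proof (cases x)
    case (Fin a)
    obtain u where u: "\<And>y. y \<in> X \<Longrightarrow> y \<le> u" using bdd by (auto simp: bdd_above_def)
    obtain c where c: "u = Fin c" using u[OF x] Fin by (cases u) auto
    have "bdd_above (Fin -` X)" using u c by (intro bdd_aboveI[of _ c]) force
    then have "a \<le> Sup (Fin -` X)" using x Fin by (intro cSup_upper) auto
    then show ?thesis using x Fin by (auto simp: Sup_zbar_def)
  qed simp
  show "Sup X \<le> z" if ne: "X \<noteq> {}" and le: "\<And>x. x \<in> X \<Longrightarrow> x \<le> z"
  proof (cases "Fin -` X = {}")
    case False
    then obtain b where "Fin b \<in> X" by auto
    then obtain c where c: "z = Fin c" using le[of "Fin b"] by (cases z) auto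
    have "Sup (Fin -` X) \<le> c" using False le c by (intro cSup_least) force+
    then show ?thesis using c False by (simp add: Sup_zbar_def)
  qed (simp add: Sup_zbar_def)
qed

end

text \<open>
  Sequences over the primes are functions on \<^typ>\<open>nat\<close> of which only the values at
  primes matter; equations between them are stated at primes only.
\<close>

definition plog :: "rat \<Rightarrow> nat \<Rightarrow> int" where
  "plog r p =
     int (multiplicity (int p) (fst (quotient_of r))) -
     int (multiplicity (int p) (snd (quotient_of r)))"

definition lgcd :: "rat set \<Rightarrow> nat \<Rightarrow> zbar" where
  "lgcd R p = (INF x \<in> R - {0}. Fin (plog \<bar>x\<bar> p))"

definition rat_group :: "rat monoid" where
  "rat_group = \<lparr>carrier = UNIV, monoid.mult = (+), one = 0\<rparr>"

lemma group_rat_group: "group rat_group"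
proof (rule groupI)
  show "\<exists>y\<in>carrier rat_group. y \<otimes>\<^bsub>rat_group\<^esub> x = \<one>\<^bsub>rat_group\<^esub>" for x
    by (auto simp: rat_group_def intro: exI[of _ "- x"])
qed (auto simp: rat_group_def)

end

theory Submission
  imports Defs
begin

text \<open>
  Write \<open>v\<close> for the \<open>p\<close>-adic valuation.  The first, second and fourth identities follow from
  \<open>v(xy) = v x + v y\<close> and \<open>v(x + y) \<ge> min (v x) (v y)\<close>.  For the intersection, take nonzero
  \<open>x \<in> H\<close> and \<open>y \<in> K\<close> and write \<open>x / y = a / b\<close> in lowest terms: then \<open>b x = a y\<close> lies in
  \<open>H \<inter> K\<close>, and as \<open>p\<close> does not divide both \<open>a\<close> and \<open>b\<close>, its valuation is \<open>max (v x) (v y)\<close>.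
  The products \<open>xy\<close> form a subgroup because any two elements of a subgroup of the rationals
  are integer multiples of a third one.
\<close>

section \<open>The valuation on nonzero rationals\<close>

lemma plog_Fract:
  assumes "prime p" "a \<noteq> 0" "b \<noteq> 0"
  shows "plog (Fract a b) p = int (multiplicity (int p) a) - int (multiplicity (int p) b)"
proof -
  obtain c d where q: "quotient_of (Fract a b) = (c, d)" by (cases "quotient_of (Fract a b)")
  have d: "d > 0" using quotient_of_denom_pos[OF q] .
  have eq: "Fract a b = Fract c d"
    using quotient_of_div[OF q] by (simp add: Fract_of_int_quotient)
  \<comment> \<open>\<open>quotient_of\<close> reduces the fraction, so \<open>c\<close>,
    \<open>d\<close> may differ from \<open>a\<close>, \<open>b\<close>. Taking multiplicities on
    both sides of the cross-multiplied equation compares the two.\<close>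
  then have cross: "a * d = c * b" using assms d by (simp add: eq_rat)
  then have "c \<noteq> 0" using assms d by auto
  moreover have "prime_elem (int p)" using assms(1) by simp
  ultimately have "multiplicity (int p) a + multiplicity (int p) d =
      multiplicity (int p) c + multiplicity (int p) b"
    using arg_cong[OF cross, of "multiplicity (int p)"] assms d
    by (simp add: prime_elem_multiplicity_mult_distrib)
  then show ?thesis by (simp add: plog_def q)
qed

lemma plog_of_int:
  assumes "prime p" "a \<noteq> 0"
  shows "plog (of_int a) p = int (multiplicity (int p) a)"
  using plog_Fract[OF assms, of 1] by (simp add: Fract_of_int_eq)

lemma plog_mult:
  assumes "prime p" "x \<noteq> 0" "y \<noteq> 0"
  shows "plog (x * y) p = plog x p + plog y p"
proof -
  obtain a b where x: "x = Fract a b" "b > 0" by (cases x) auto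
  obtain c d where y: "y = Fract c d" "d > 0" by (cases y) auto
  have "a \<noteq> 0" "c \<noteq> 0" using assms(2,3) x y by (auto simp: rat_number_collapse)
  moreover have "prime_elem (int p)" using assms(1) by simp
  ultimately show ?thesis
    using x y assms(1) by (simp add: plog_Fract prime_elem_multiplicity_mult_distrib)
qed

text \<open>The factor -1 is a unit and has valuation 0. This removes the absolute value in
  \<open>lgcd\<close> from all later arguments.\<close>

lemma plog_abs:
  assumes "prime p" "x \<noteq> 0"
  shows "plog \<bar>x\<bar> p = plog x p"
proof (cases "x > 0")
  case False
  then have "\<bar>x\<bar> = of_int (- 1) * x" using assms(2) by simp
  moreover have "plog (of_int (- 1)) p = 0" using plog_of_int[OF assms(1), of "- 1"]
    by (simp add: multiplicity_unit_right)
  ultimately show ?thesis using plog_mult[OF assms(1), of "of_int (- 1)" x] assms(2) by simp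
qed simp

text \<open>Over the common denominator \<open>b * d\<close>, the smaller of the two powers of
  \<open>p\<close> in \<open>a * d\<close> and \<open>c * b\<close> divides the numerator of the
  sum.\<close>

lemma plog_add_ge:
  assumes "prime p" "x \<noteq> 0" "y \<noteq> 0" "x + y \<noteq> 0"
  shows "min (plog x p) (plog y p) \<le> plog (x + y) p"
proof -
  have p: "prime_elem (int p)" using assms(1) by simp
  obtain a b where x: "x = Fract a b" "b > 0" by (cases x) auto
  obtain c d where y: "y = Fract c d" "d > 0" by (cases y) auto
  have xy: "x + y = Fract (a * d + c * b) (b * d)" using x y by simp
  have nz: "a \<noteq> 0" "c \<noteq> 0" "a * d + c * b \<noteq> 0"
    using assms(2-4) x y xy by (auto simp: rat_number_collapse)
  let ?m = "min (multiplicity (int p) (a * d)) (multiplicity (int p) (c * b))"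
  have "int p ^ ?m dvd a * d + c * b"
    by (intro dvd_add multiplicity_dvd') auto
  then have "?m \<le> multiplicity (int p) (a * d + c * b)"
    using nz p by (intro multiplicity_geI) auto
  then show ?thesis
    unfolding xy using x y nz p assms(1)
    by (auto simp: plog_Fract prime_elem_multiplicity_mult_distrib min_def split: if_splits)
qed

section \<open>Order properties of \<open>lgcd\<close>\<close>

lemma lgcd_le:
  assumes "prime p" "x \<in> R" "x \<noteq> 0"
  shows "lgcd R p \<le> Fin (plog x p)"
proof -
  \<comment> \<open>\<open>MInf\<close> is a least element, so every set of values is bounded
    below.\<close>
  have "bdd_below ((\<lambda>x. Fin (plog \<bar>x\<bar> p)) ` (R - {0}))"
    by (rule bdd_belowI[of _ MInf]) simp
  then have "lgcd R p \<le> Fin (plog \<bar>x\<bar> p)"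
    unfolding lgcd_def using assms(2,3) by (intro cINF_lower) auto
  then show ?thesis using assms by (simp add: plog_abs)
qed

lemma lgcd_greatest:
  assumes "prime p" "R - {0} \<noteq> {}"
    and "\<And>x. x \<in> R \<Longrightarrow> x \<noteq> 0 \<Longrightarrow> z \<le> Fin (plog x p)"
  shows "z \<le> lgcd R p"
  unfolding lgcd_def using assms by (intro cINF_greatest) (auto simp: plog_abs)

text \<open>This is how an infimum equal to \<open>MInf\<close> is exploited: no element attains it,
  but some element lies below any given larger bound.\<close>

lemma lgcd_lessD:
  assumes "prime p" "R - {0} \<noteq> {}" "lgcd R p < z"
  obtains x where "x \<in> R" "x \<noteq> 0" "Fin (plog x p) < z"
  using lgcd_greatest[OF assms(1,2), of z] assms(3) by (metis not_le)

lemma lgcd_antimono: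
  assumes "prime p" "R - {0} \<noteq> {}" "R \<subseteq> S"
  shows "lgcd S p \<le> lgcd R p"
  using assms by (intro lgcd_greatest lgcd_le) auto

text \<open>A finite infimum of integers is a minimum: a valuation below \<open>a + 1\<close> and at
  least \<open>a\<close> equals \<open>a\<close>.\<close>

lemma lgcd_attained:
  assumes "prime p" "R - {0} \<noteq> {}" "lgcd R p = Fin a"
  obtains x where "x \<in> R" "x \<noteq> 0" "plog x p = a"
proof -
  have "lgcd R p < Fin (a + 1)" using assms(3) by (simp add: less_zbar_def)
  then obtain x where x: "x \<in> R" "x \<noteq> 0" "Fin (plog x p) < Fin (a + 1)"
    using lgcd_lessD[OF assms(1,2)] by blast
  with lgcd_le[OF assms(1) x(1,2)] assms(3) have "plog x p = a"
    by (simp add: less_zbar_def)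
  with x that show thesis by blast
qed

section \<open>Products of sets\<close>

lemma lgcd_mult_MInf:
  assumes p: "prime p" and R: "R - {0} \<noteq> {}" and S: "S - {0} \<noteq> {}" and "lgcd R p = MInf"
  shows "lgcd (R * S) p = MInf"
proof (cases "lgcd (R * S) p")
  case (Fin c)
  obtain y where y: "y \<in> S" "y \<noteq> 0" using S by blast
  \<comment> \<open>The bound is chosen so that \<open>x * y\<close> gets valuation below
    \<open>c\<close>, contradicting the assumed value \<open>Fin c\<close> of the infimum.\<close>
  have "lgcd R p < Fin (c - plog y p)" using assms(4) by (simp add: less_zbar_def)
  then obtain x where x: "x \<in> R" "x \<noteq> 0" "Fin (plog x p) < Fin (c - plog y p)"
    using lgcd_lessD[OF p R] by blast
  have "lgcd (R * S) p \<le> Fin (plog (x * y) p)"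
    using x y p by (intro lgcd_le set_times_intro) auto
  then show ?thesis using Fin x y p by (simp add: plog_mult less_zbar_def)
qed

text \<open>If both infima are finite, the product of two minimizers attains their sum; otherwise
  \<open>MInf\<close> absorbs. Arbitrary sets are allowed so that a singleton factor also yields the
  scaling identity.\<close>

lemma lgcd_mult:
  assumes p: "prime p" and R: "R - {0} \<noteq> {}" and S: "S - {0} \<noteq> {}"
  shows "lgcd (R * S) p = lgcd R p + lgcd S p"
proof (cases "lgcd R p"; cases "lgcd S p")
  fix a b assume ab: "lgcd R p = Fin a" "lgcd S p = Fin b"
  obtain x where x: "x \<in> R" "x \<noteq> 0" "plog x p = a" using lgcd_attained[OF p R ab(1)] .
  obtain y where y: "y \<in> S" "y \<noteq> 0" "plog y p = b" using lgcd_attained[OF p S ab(2)] .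
  have xy: "x * y \<in> R * S" "x * y \<noteq> 0" using x y by (auto intro: set_times_intro)
  have "lgcd (R * S) p \<le> Fin (a + b)" using lgcd_le[OF p xy] x y p by (simp add: plog_mult)
  moreover have "Fin (a + b) \<le> lgcd (R * S) p"
  proof (rule lgcd_greatest[OF p])
    show "R * S - {0} \<noteq> {}" using xy by blast
    fix z assume "z \<in> R * S" "z \<noteq> 0"
    then obtain s t where "z = s * t" "s \<in> R" "t \<in> S" "s \<noteq> 0" "t \<noteq> 0"
      by (auto elim: set_times_elim)
    then show "Fin (a + b) \<le> Fin (plog z p)"
      using lgcd_le[OF p, of s R] lgcd_le[OF p, of t S] ab p by (simp add: plog_mult)
  qed
  ultimately show ?thesis using ab by simp
next
  assume "lgcd S p = MInf"
  then have "lgcd (S * R) p = MInf" using lgcd_mult_MInf[OF p S R] by simp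
  then show "lgcd (R * S) p = lgcd R p + lgcd S p" if "lgcd R p = Fin a" for a
    using that \<open>lgcd S p = MInf\<close> by (simp add: mult.commute)
qed (use lgcd_mult_MInf[OF p R S] in auto)

lemma lgcd_singleton:
  assumes "prime p" "r \<noteq> 0"
  shows "lgcd {r} p = Fin (plog r p)"
  using assms by (simp add: lgcd_def plog_abs insert_Diff_if)

section \<open>Subgroups of the rationals\<close>

lemma inv_rat_group: "inv\<^bsub>rat_group\<^esub> x = - x"
  by (rule group.inv_equality[OF group_rat_group]) (auto simp: rat_group_def)

lemma subgroup_rat_group_iff:
  "subgroup H rat_group \<longleftrightarrow> 0 \<in> H \<and> (\<forall>x\<in>H. \<forall>y\<in>H. x + y \<in> H) \<and> (\<forall>x\<in>H. - x \<in> H)"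
  by (auto simp: subgroup_def inv_rat_group) (auto simp: rat_group_def)

lemma subgroup_of_int_mult:
  assumes H: "subgroup H rat_group" and x: "x \<in> H"
  shows "of_int n * x \<in> H"
proof (induction n rule: int_induct[of _ 0])
  case base
  show ?case using H by (simp add: subgroup_rat_group_iff)
next
  case (step1 i)
  then have "of_int i * x + x \<in> H" using H x by (simp add: subgroup_rat_group_iff)
  then show ?case by (simp add: algebra_simps)
next
  case (step2 i)
  then have "of_int i * x + - x \<in> H" using H x unfolding subgroup_rat_group_iff by blast
  then show ?case by (simp add: algebra_simps)
qed

text \<open>Over a common denominator, the gcd of the two numerators gives the common generator
  \<open>z\<close>. Bezout coefficients express \<open>z\<close> as an integer combination of
  \<open>x\<close> and \<open>y\<close>, which puts it into \<open>H\<close>.\<close>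

lemma rat_subgroup_locally_cyclic:
  assumes H: "subgroup H rat_group" and "x \<in> H" "y \<in> H"
  obtains z m n where "z \<in> H" "x = of_int m * z" "y = of_int n * z"
proof -
  obtain a b where x: "x = Fract a b" "b > 0" by (cases x) auto
  obtain c d where y: "y = Fract c d" "d > 0" by (cases y) auto
  obtain u v where uv: "u * (a * d) + v * (c * b) = gcd (a * d) (c * b)"
    using bezout_int by blast
  obtain m n where mn: "a * d = gcd (a * d) (c * b) * m" "c * b = gcd (a * d) (c * b) * n"
    by (meson dvd_def gcd_dvd1 gcd_dvd2)
  define g where "g = gcd (a * d) (c * b)"
  define z where "z = of_int u * x + of_int v * y"
  have bd: "of_int b \<noteq> (0::rat)" "of_int d \<noteq> (0::rat)" using x y by auto
  have xq: "x = of_int (a * d) / of_int (b * d)" and yq: "y = of_int (c * b) / of_int (b * d)"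
    using x y bd by (auto simp: Fract_of_int_quotient)
  have "z = of_int (u * (a * d) + v * (c * b)) / of_int (b * d)"
    unfolding z_def xq yq by (simp add: add_divide_distrib)
  then have z: "z = of_int g / of_int (b * d)" using uv by (simp only: g_def)
  have "x = of_int m * z" "y = of_int n * z"
    unfolding xq yq z using mn[folded g_def] by (simp_all only: of_int_mult) simp_all
  moreover have "z \<in> H"
    unfolding z_def using H subgroup_of_int_mult[OF H] assms(2,3)
    by (simp add: subgroup_rat_group_iff)
  ultimately show thesis using that by blast
qed

lemma subgroup_rat_group_mult:
  assumes H: "subgroup H rat_group" and K: "subgroup K rat_group"
  shows "subgroup (H * K) rat_group"
  unfolding subgroup_rat_group_iff
proof (intro conjI ballI)
  show "0 \<in> H * K"
    using H K set_times_intro[of 0 H 0 K] by (simp add: subgroup_rat_group_iff)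
next
  fix z assume "z \<in> H * K"
  then obtain x y where z: "z = x * y" "x \<in> H" "y \<in> K" by (rule set_times_elim)
  then have "- x * y \<in> H * K" using H by (intro set_times_intro) (auto simp: subgroup_rat_group_iff)
  then show "- z \<in> H * K" using z by simp
next
  fix z w assume "z \<in> H * K" "w \<in> H * K"
  then obtain x y s t where z: "z = x * y" "x \<in> H" "y \<in> K" and w: "w = s * t" "s \<in> H" "t \<in> K"
    by (metis set_times_elim)
  \<comment> \<open>Common generators \<open>h\<close> of \<open>x\<close>, \<open>s\<close> and
    \<open>k\<close> of \<open>y\<close>, \<open>t\<close> turn both products into integer multiples
    of \<open>h * k\<close>, so that their sum is again a single product.\<close>
  obtain h a b where h: "h \<in> H" "x = of_int a * h" "s = of_int b * h"
    using rat_subgroup_locally_cyclic[OF H z(2) w(2)] .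
  obtain k c d where k: "k \<in> K" "y = of_int c * k" "t = of_int d * k"
    using rat_subgroup_locally_cyclic[OF K z(3) w(3)] .
  have "z + w = (of_int (a * c + b * d) * h) * k"
    using z w h k by (simp add: algebra_simps)
  then show "z + w \<in> H * K"
    using subgroup_of_int_mult[OF H h(1)] k(1) by (simp only: set_times_intro)
qed

section \<open>Sums of subgroups\<close>

lemma lgcd_add:
  assumes p: "prime p" and H: "0 \<in> H" "H - {0} \<noteq> {}" and K: "0 \<in> K" "K - {0} \<noteq> {}"
  shows "lgcd (H + K) p = min (lgcd H p) (lgcd K p)"
proof (rule antisym)
  have sub: "H \<subseteq> H + K" "K \<subseteq> H + K"
    using set_zero_plus2[OF H(1), of K] set_zero_plus2[OF K(1), of H]
    by (simp_all add: add.commute)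
  then show "lgcd (H + K) p \<le> min (lgcd H p) (lgcd K p)"
    using lgcd_antimono[OF p H(2)] lgcd_antimono[OF p K(2)] by simp
  show "min (lgcd H p) (lgcd K p) \<le> lgcd (H + K) p"
  proof (rule lgcd_greatest[OF p])
    show "H + K - {0} \<noteq> {}" using sub H(2) by blast
    fix z assume "z \<in> H + K" and nz: "z \<noteq> 0"
    then obtain x y where z: "z = x + y" and x: "x \<in> H" and y: "y \<in> K"
      by (auto elim: set_plus_elim)
    \<comment> \<open>Zero summands are split off because \<open>plog 0 p\<close> has the default
      value 0 instead of infinity, so the ultrametric inequality is available for nonzero summands
      only.\<close>
    consider "x = 0" | "y = 0" | "x \<noteq> 0" "y \<noteq> 0" by blast
    then show "min (lgcd H p) (lgcd K p) \<le> Fin (plog z p)"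
    proof cases
      case 1
      then show ?thesis using lgcd_le[OF p y] z nz by (simp add: min.coboundedI2)
    next
      case 2
      then show ?thesis using lgcd_le[OF p x] z nz by (simp add: min.coboundedI1)
    next
      case 3
      then have "plog x p \<le> plog z p \<or> plog y p \<le> plog z p"
        using plog_add_ge[OF p 3] z nz by (simp add: min_le_iff_disj)
      then have "Fin (plog x p) \<le> Fin (plog z p) \<or> Fin (plog y p) \<le> Fin (plog z p)" by simp
      then show ?thesis
        using lgcd_le[OF p x 3(1)] lgcd_le[OF p y 3(2)] by (meson min_le_iff_disj order_trans)
    qed
  qed
qed

section \<open>Intersections of subgroups\<close>

lemma subgroup_inter_plog_le_max:
  assumes p: "prime p" and H: "subgroup H rat_group" and K: "subgroup K rat_group"
    and x: "x \<in> H" "x \<noteq> 0" and y: "y \<in> K" "y \<noteq> 0"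
  obtains z where "z \<in> H \<inter> K" "z \<noteq> 0" "plog z p \<le> max (plog x p) (plog y p)"
proof -
  obtain a b where q: "quotient_of (x / y) = (a, b)" by (cases "quotient_of (x / y)")
  have b: "b \<noteq> 0" using quotient_of_denom_pos[OF q] by simp
  have xy: "x / y = of_int a / of_int b" using quotient_of_div[OF q] .
  then have a: "a \<noteq> 0" using x y b by auto
  have eq: "of_int b * x = of_int a * y" using xy y b by (simp add: field_simps)
  have "of_int b * x \<in> H \<inter> K"
    using subgroup_of_int_mult[OF H x(1), of b] subgroup_of_int_mult[OF K y(1), of a] eq by simp
  moreover have "of_int b * x \<noteq> 0" using x b by simp
  \<comment> \<open>One of the coprime integers \<open>a\<close>, \<open>b\<close> is prime to
    \<open>p\<close>, and multiplying by it preserves the valuation. The element is both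
    \<open>b x\<close> and \<open>a y\<close>, so its valuation is that of \<open>x\<close> or of
    \<open>y\<close>.\<close>
  moreover have "plog (of_int b * x) p \<le> max (plog x p) (plog y p)"
  proof (cases "int p dvd b")
    case True
    moreover have "coprime a b" using quotient_of_coprime[OF q] .
    moreover have "\<not> is_unit (int p)" using p by (auto dest: prime_gt_1_nat)
    ultimately have "\<not> int p dvd a" using coprime_common_divisor by blast
    then have "plog (of_int a * y) p = plog y p"
      using p a y by (simp add: plog_mult plog_of_int not_dvd_imp_multiplicity_0)
    then show ?thesis using eq by simp
  next
    case False
    then have "plog (of_int b * x) p = plog x p"
      using p b x by (simp add: plog_mult plog_of_int not_dvd_imp_multiplicity_0)
    then show ?thesis by simp
  qed
  ultimately show thesis using that by blast
qed

lemma lgcd_inter: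
  assumes p: "prime p" and H: "subgroup H rat_group" "H - {0} \<noteq> {}"
    and K: "subgroup K rat_group" "K - {0} \<noteq> {}"
  shows "lgcd (H \<inter> K) p = max (lgcd H p) (lgcd K p)"
proof (rule antisym)
  \<comment> \<open>Nontrivial subgroups of the rationals meet nontrivially; otherwise
    \<open>lgcd\<close> of the intersection would be the meaningless
    \<open>Inf {} = MInf\<close>.\<close>
  have "H \<inter> K - {0} \<noteq> {}"
    using subgroup_inter_plog_le_max[OF p H(1) K(1)] H(2) K(2) by (metis DiffD1 DiffD2 DiffI
      ex_in_conv singleton_iff)
  then show "max (lgcd H p) (lgcd K p) \<le> lgcd (H \<inter> K) p"
    using lgcd_antimono[OF p] by simp
  show "lgcd (H \<inter> K) p \<le> max (lgcd H p) (lgcd K p)"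
  \<comment> \<open>Either infimum may be \<open>MInf\<close> and hence not attained. Arguing by
    contradiction, it suffices to have \<open>x\<close> and \<open>y\<close> with valuations
    strictly below \<open>lgcd (H \<inter> K) p\<close>.\<close>
  proof (rule ccontr)
    assume "\<not> lgcd (H \<inter> K) p \<le> max (lgcd H p) (lgcd K p)"
    then have less: "lgcd H p < lgcd (H \<inter> K) p" "lgcd K p < lgcd (H \<inter> K) p"
      by (simp_all add: le_max_iff_disj not_le)
    obtain x where x: "x \<in> H" "x \<noteq> 0" "Fin (plog x p) < lgcd (H \<inter> K) p"
      using lgcd_lessD[OF p H(2) less(1)] .
    obtain y where y: "y \<in> K" "y \<noteq> 0" "Fin (plog y p) < lgcd (H \<inter> K) p"
      using lgcd_lessD[OF p K(2) less(2)] .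
    obtain z where z: "z \<in> H \<inter> K" "z \<noteq> 0" "plog z p \<le> max (plog x p) (plog y p)"
      using subgroup_inter_plog_le_max[OF p H(1) K(1) x(1,2) y(1,2)] .
    have "Fin (plog z p) \<le> max (Fin (plog x p)) (Fin (plog y p))"
      using z(3) by (simp add: le_max_iff_disj)
    also have "\<dots> < lgcd (H \<inter> K) p" using x(3) y(3) by simp
    also have "\<dots> \<le> Fin (plog z p)" using lgcd_le[OF p z(1,2)] .
    finally show False by simp
  qed
qed

theorem proposition3p5:
  fixes r :: rat and H K :: "rat set"
  assumes "r > 0"
    and "subgroup H rat_group" and "H \<noteq> {0}"
    and "subgroup K rat_group" and "K \<noteq> {0}"
  shows "(\<forall>p. prime p \<longrightarrow> lgcd (r *o H) p = Fin (plog r p) + lgcd H p)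
    \<and> (\<forall>p. prime p \<longrightarrow> lgcd (H + K) p = min (lgcd H p) (lgcd K p))
    \<and> (\<forall>p. prime p \<longrightarrow> lgcd (H \<inter> K) p = max (lgcd H p) (lgcd K p))
    \<and> subgroup (H * K) rat_group
    \<and> (\<forall>p. prime p \<longrightarrow> lgcd (H * K) p = lgcd H p + lgcd K p)"
proof -
  have zero: "0 \<in> H" "0 \<in> K" using assms by (auto simp: subgroup_rat_group_iff)
  with assms have H: "H - {0} \<noteq> {}" and K: "K - {0} \<noteq> {}" by blast+
  \<comment> \<open>Scaling is multiplication by the set \<open>{r}\<close>, so the first identity
    is a case of \<open>lgcd_mult\<close>.\<close>
  have scale: "r *o H = {r} * H" by (auto simp: elt_set_times_def set_times_def)
  have "lgcd (r *o H) p = Fin (plog r p) + lgcd H p" if "prime p" for p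
    unfolding scale using lgcd_mult[OF that, of "{r}" H] lgcd_singleton[OF that, of r] assms(1) H
    by (simp add: insert_Diff_if)
  then show ?thesis
    using lgcd_add[OF _ zero(1) H zero(2) K] lgcd_inter[OF _ assms(2) H assms(4) K]
      subgroup_rat_group_mult[OF assms(2,4)] lgcd_mult[OF _ H K] by simp
qed

end
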